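(* Define $\bar\alpha_1=1$ and $\bar\alpha_{k+1}=\dfrac{2}{1+\sqrt{1+4/\bar\alpha_k^{2}}}$ for $k\ge1$. For each integer $k\ge 8$, among all pairs $(a,b)$ with $a>0$, $0<b<1$ and $a(1-b)2^{2-b}-ab(1-b)2^{-b}-1\ge0$, the quantity $$\frac{2}{(1+a\,k^{-b})k+1}$$ (which is a lower bound for $\bar\alpha_k$) is maximized at $$\bar a_k=\frac{2^{\bar b_k}}{(1-\bar b_k)(4-\bar b_k)},\qquad \bar b_k=\frac{2+5\log\frac2k+\sqrt{9\left(\log\frac2k\right)^2+4}}{2\log\frac2k}.$$ Consequently, $$\frac{k+1}{2}-\bar\alpha_k^{-1}=O(\log k)\qquad (k\to\infty).$$
   Context: $\log$ denotes the natural logarithm. *)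

theory Defs
  imports Complex_Main "HOL-Library.Landau_Symbols"
begin

definition feasible :: "real \<times> real \<Rightarrow> bool" where
  "feasible = (\<lambda>(a, b). a > 0 \<and> 0 < b \<and> b < 1 \<and>
     a * (1 - b) * 2 powr (2 - b) - a * b * (1 - b) * 2 powr (- b) - 1 \<ge> 0)"

definition lower_bound :: "nat \<Rightarrow> real \<times> real \<Rightarrow> real" where
  "lower_bound k = (\<lambda>(a, b). 2 / ((1 + a * real k powr (- b)) * real k + 1))"

definition b_bar :: "nat \<Rightarrow> real" where
  "b_bar k = (2 + 5 * ln (2 / real k) + sqrt (9 * (ln (2 / real k))\<^sup>2 + 4)) / (2 * ln (2 / real k))"

definition a_bar :: "nat \<Rightarrow> real" where
  "a_bar k = 2 powr b_bar k / ((1 - b_bar k) * (4 - b_bar k))"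

end

theory Submission imports Defs begin

text \<open>
  The reciprocals \<open>x k = inverse (\<alpha> k)\<close> satisfy \<open>x (k + 1) = (1 + sqrt (1 + 4 * (x k)\<^sup>2)) / 2\<close>.
  The right-hand side is monotone in \<open>x k\<close>, and the mean value theorem shows that for feasible
  \<open>(a, b)\<close> the sequence \<open>(k + 1 + a * k powr (1 - b)) / 2\<close> is a supersolution, so it dominates \<open>x\<close>.
  For fixed \<open>b\<close> the best \<open>a\<close> makes the constraint tight; it remains to minimize
  \<open>b * ln (2 / k) - ln (1 - b) - ln (4 - b)\<close>, a convex function of \<open>b\<close> whose critical point
  in \<open>(0, 1)\<close> is a root of a quadratic equation, namely \<open>b_bar k\<close>.
  The choice \<open>b = 1 - 1 / ln k\<close> already gives the logarithmic error.
\<close>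

text \<open>Factoring out \<open>(1 - b) * 2 powr (- b)\<close> turns the constraint into a lower
  bound on \<open>a\<close> by a positive number, which makes positivity of \<open>a\<close>
  automatic.\<close>

lemma feasible_iff:
  "feasible (a, b) \<longleftrightarrow> 0 < b \<and> b < 1 \<and> 2 powr b / ((1 - b) * (4 - b)) \<le> a"
proof (cases "0 < b \<and> b < 1")
  case True
  define D where "D = (1 - b) * (4 - b)"
  have D: "D > 0"
    using True by (simp add: D_def)
  have p: "2 powr (2 - b) = 4 / 2 powr b" "2 powr (- b) = 1 / 2 powr b"
    by (simp_all add: powr_diff powr_minus_divide)
  have "a * (1 - b) * 2 powr (2 - b) - a * b * (1 - b) * 2 powr (- b) = a * D / 2 powr b"
    unfolding p D_def by (simp add: algebra_simps diff_divide_distrib add_divide_distrib)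
  also have "\<dots> - 1 \<ge> 0 \<longleftrightarrow> 2 powr b / D \<le> a"
    using D by (simp add: pos_divide_le_eq pos_le_divide_eq)
  finally have "feasible (a, b) \<longleftrightarrow> a > 0 \<and> 2 powr b / D \<le> a"
    using True by (simp add: feasible_def)
  moreover have "0 < 2 powr b / D"
    using D by simp
  ultimately show ?thesis
    using True unfolding D_def by linarith
qed (auto simp: feasible_def)

text \<open>The derivative \<open>c * z powr (c - 1)\<close> decreases in \<open>z\<close> because
  \<open>c < 1\<close>, so its value at the right endpoint bounds the mean value from below.\<close>

lemma powr_increment_ge:
  fixes c x :: real
  assumes "0 < c" "c < 1" "0 < x"
  shows "c * (x + 1) powr (c - 1) \<le> (x + 1) powr c - x powr c"
proof -
  have "\<exists>z>x. z < x + 1 \<and> (x + 1) powr c - x powr c = (x + 1 - x) * (c * z powr (c - 1))"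
    using assms by (intro MVT2) (auto intro!: has_real_derivative_powr)
  then obtain z where z: "x < z" "z < x + 1" "(x + 1) powr c - x powr c = c * z powr (c - 1)"
    by auto
  have "(x + 1) powr (c - 1) \<le> z powr (c - 1)"
    using assms z by (intro powr_mono2') auto
  then show ?thesis
    using z assms by simp
qed

text \<open>With \<open>p\<close> and \<open>q\<close> as below, the claim amounts to
  \<open>1 \<le> (x + 1 + a * q)\<^sup>2 - (x + 1 + a * p)\<^sup>2\<close>, and this difference of
  squares has the factor \<open>a * (q - p)\<close>.\<close>

lemma feasible_supersolution:
  fixes x a b :: real
  assumes ab: "feasible (a, b)" and x: "1 \<le> x"
  defines "u \<equiv> \<lambda>x. (x + 1 + a * x powr (1 - b)) / 2"
  shows "(1 + sqrt (1 + 4 * (u x)\<^sup>2)) / 2 \<le> u (x + 1)"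
proof -
  have a: "a > 0" and b: "0 < b" "b < 1"
    and f: "a * (1 - b) * 2 powr (2 - b) - a * b * (1 - b) * 2 powr (- b) \<ge> 1"
    using ab by (auto simp: feasible_def)
  define p q where "p = x powr (1 - b)" and "q = (x + 1) powr (1 - b)"
  have "0 \<le> a * b * (1 - b) * 2 powr (- b)"
    using a b by simp
  then have "1 \<le> a * (1 - b) * 2 powr (2 - b)"
    using f by linarith
  also have "\<dots> = 2 * (a * (1 - b) * 2 powr (1 - b))"
    by (simp add: powr_diff)
  \<comment> \<open>The base 2 may grow to \<open>x + 1\<close> since
    \<open>1 \<le> x\<close>.\<close>
  also have "\<dots> \<le> 2 * (a * (1 - b) * (x + 1) powr (1 - b))"
    using a b x by (intro mult_left_mono powr_mono2) auto
  also have "\<dots> = a * ((1 - b) * (x + 1) powr (1 - b - 1)) * (2 * (x + 1))"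
    using x by (simp add: powr_diff powr_minus field_simps)
  also have "\<dots> \<le> a * (q - p) * (2 * (x + 1))"
    using powr_increment_ge[of "1 - b" x] a b x unfolding p_def q_def
    by (intro mult_right_mono mult_left_mono) auto
  also have "\<dots> \<le> a * (q - p) * (2 * (x + 1) + a * (q + p))"
  proof (intro mult_left_mono)
    show "0 \<le> a * (q - p)"
      using a b x unfolding p_def q_def
      by (intro mult_nonneg_nonneg) (auto intro!: powr_mono2)
    show "2 * (x + 1) \<le> 2 * (x + 1) + a * (q + p)"
      using a by (simp add: p_def q_def)
  qed
  also have "\<dots> = (x + 1 + a * q)\<^sup>2 - (x + 1 + a * p)\<^sup>2"
    by (simp add: power2_eq_square algebra_simps)
  finally have "1 + 4 * (u x)\<^sup>2 \<le> (x + 1 + a * q)\<^sup>2"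
    by (simp add: u_def p_def power_divide)
  then have "sqrt (1 + 4 * (u x)\<^sup>2) \<le> x + 1 + a * q"
    using a x by (intro real_le_lsqrt) (auto simp: q_def)
  then show ?thesis
    by (simp add: u_def q_def)
qed

text \<open>Each step adds at least 1/2, as
  \<open>sqrt (1 + 4 * t\<^sup>2) \<ge> 2 * t\<close>.\<close>

lemma recurrence_ge:
  fixes x :: "nat \<Rightarrow> real"
  assumes x1: "x 1 = 1"
    and step: "\<And>k. k \<ge> 1 \<Longrightarrow> x (k + 1) = (1 + sqrt (1 + 4 * (x k)\<^sup>2)) / 2"
    and k: "k \<ge> 1"
  shows "(real k + 1) / 2 \<le> x k"
  using k
proof (induction k rule: nat_induct_at_least)
  case base
  then show ?case
    using x1 by simp
next
  case (Suc k)
  have "2 * x k \<le> sqrt (1 + 4 * (x k)\<^sup>2)"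
    by (intro real_le_rsqrt) (simp add: power_mult_distrib)
  moreover have "x (Suc k) = (1 + sqrt (1 + 4 * (x k)\<^sup>2)) / 2"
    using step[OF Suc.hyps] by simp
  ultimately show ?case
    using Suc.IH by (simp add: field_simps)
qed

lemma recurrence_le:
  fixes x :: "nat \<Rightarrow> real"
  assumes x1: "x 1 = 1"
    and step: "\<And>k. k \<ge> 1 \<Longrightarrow> x (k + 1) = (1 + sqrt (1 + 4 * (x k)\<^sup>2)) / 2"
    and k: "k \<ge> 1"
    and ab: "feasible (a, b)"
  shows "x k \<le> (real k + 1 + a * real k powr (1 - b)) / 2"
  using k
proof (induction k rule: nat_induct_at_least)
  case base
  then show ?case
    using ab x1 by (simp add: feasible_def)
next
  case (Suc k)
  \<comment> \<open>Squaring the induction hypothesis requires \<open>x k\<close> to be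
    nonnegative.\<close>
  have "0 \<le> (real k + 1) / 2"
    by simp
  also have "\<dots> \<le> x k"
    using recurrence_ge[OF x1 step Suc.hyps] .
  finally have "(x k)\<^sup>2 \<le> ((real k + 1 + a * real k powr (1 - b)) / 2)\<^sup>2"
    using Suc.IH by (intro power_mono)
  then have "(1 + sqrt (1 + 4 * (x k)\<^sup>2)) / 2
      \<le> (1 + sqrt (1 + 4 * ((real k + 1 + a * real k powr (1 - b)) / 2)\<^sup>2)) / 2"
    by (intro divide_right_mono add_left_mono real_sqrt_le_mono mult_left_mono) auto
  also have "\<dots> \<le> (real k + 1 + 1 + a * (real k + 1) powr (1 - b)) / 2"
    using Suc.hyps by (intro feasible_supersolution[OF ab]) simp
  finally show ?case
    using step[OF Suc.hyps] by (simp add: add_ac)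
qed

text \<open>In this form, maximizing the bound means minimizing
  \<open>a * real k powr (1 - b)\<close>.\<close>

lemma lower_bound_eq:
  assumes "k \<ge> 1"
  shows "lower_bound k (a, b) = 2 / (real k + 1 + a * real k powr (1 - b))"
  using assms by (simp add: lower_bound_def powr_diff powr_minus field_simps)

text \<open>The objective \<open>b * L - ln (1 - b) - ln (4 - b)\<close> with
  \<open>L = ln (2 / k)\<close> has slope \<open>L + 5 / 4\<close> at \<open>b = 0\<close>; a
  negative slope there puts the minimizer to the right of 0. Numerically,
  \<open>exp 5 \<le> 3 ^ 5 < 4 ^ 4\<close>.\<close>

lemma ln_two_over_less:
  assumes "k \<ge> (8::nat)"
  shows "ln (2 / real k) < - 5 / 4"
proof -
  have "exp (5::real) = exp 1 ^ 5"
    by (simp flip: exp_of_nat_mult)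
  also have "\<dots> \<le> 3 ^ 5"
    by (intro power_mono exp_le) auto
  also have "\<dots> < (4::real) ^ 4"
    by simp
  also have "\<dots> = exp (ln (4 ^ 4))"
    by simp
  finally have "5 < ln ((4::real) ^ 4)"
    by (simp only: exp_less_cancel_iff)
  then have "5 / 4 < ln (4::real)"
    unfolding ln_realpow by simp
  also have "\<dots> \<le> ln (real k / 2)"
    using assms by simp
  also have "\<dots> = - ln (2 / real k)"
    using assms by (simp add: ln_div)
  finally show ?thesis
    by simp
qed

lemma
  assumes k: "k \<ge> 8"
  shows b_bar_bounds: "0 < b_bar k" "b_bar k < 1"
    and b_bar_critical: "ln (2 / real k) + 1 / (1 - b_bar k) + 1 / (4 - b_bar k) = 0"
proof -
  define L where "L = ln (2 / real k)"
  define s where "s = sqrt (9 * L\<^sup>2 + 4)"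
  have L: "L < - 5 / 4"
    using ln_two_over_less[OF k] by (simp add: L_def)
  have b: "b_bar k = (2 + 5 * L + s) / (2 * L)"
    by (simp add: b_bar_def L_def s_def)
  have s2: "s\<^sup>2 = 9 * L\<^sup>2 + 4"
    unfolding s_def by (intro real_sqrt_pow2 add_nonneg_nonneg) auto
  \<comment> \<open>Four times this product is
    \<open>(- 5 * L - 2)\<^sup>2 - (9 * L\<^sup>2 + 4)\<close>.\<close>
  have "0 < - L * (- 5 - 4 * L)"
    using L by (intro mult_pos_pos) auto
  then have "s < - 5 * L - 2"
    unfolding s_def using L
    by (intro real_less_lsqrt) (auto simp: power2_eq_square algebra_simps)
  then show "0 < b_bar k"
    using L by (auto simp: b intro!: divide_neg_neg)
  have "- 3 * L \<le> s"
    unfolding s_def by (intro real_le_rsqrt) (simp add: power_mult_distrib)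
  then show less1: "b_bar k < 1"
    using L by (simp add: b neg_divide_less_eq)
  \<comment> \<open>Isolating the root and squaring undoes the quadratic formula; the result is
    \<open>4 * L\<close> times the critical equation with denominators cleared.\<close>
  have "s = 2 * L * b_bar k - 2 - 5 * L"
    using L by (simp add: b)
  then have "(2 * L * b_bar k - 2 - 5 * L)\<^sup>2 = 9 * L\<^sup>2 + 4"
    using s2 by simp
  then have "4 * L * (L * ((1 - b_bar k) * (4 - b_bar k)) + (5 - 2 * b_bar k)) = 0"
    by (simp add: power2_eq_square algebra_simps)
  then have "L * ((1 - b_bar k) * (4 - b_bar k)) + (5 - 2 * b_bar k) = 0"
    using L by simp
  then show "ln (2 / real k) + 1 / (1 - b_bar k) + 1 / (4 - b_bar k) = 0"
    using less1 unfolding L_def[symmetric] by (simp add: field_simps)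
qed

lemma feasible_bar: "k \<ge> 8 \<Longrightarrow> feasible (a_bar k, b_bar k)"
  using b_bar_bounds by (simp add: feasible_iff a_bar_def)

lemma bar_minimizes:
  assumes k: "k \<ge> 8" and ab: "feasible (a, b)"
  shows "a_bar k * real k powr (1 - b_bar k) \<le> a * real k powr (1 - b)"
proof -
  define \<beta> where "\<beta> = b_bar k"
  define L where "L = ln (2 / real k)"
  have b: "0 < b" "b < 1" and a: "2 powr b / ((1 - b) * (4 - b)) \<le> a"
    using ab by (auto simp: feasible_iff)
  have \<beta>: "0 < \<beta>" "\<beta> < 1" and crit: "L + 1 / (1 - \<beta>) + 1 / (4 - \<beta>) = 0"
    using b_bar_bounds[OF k] b_bar_critical[OF k] by (auto simp: \<beta>_def L_def)
  \<comment> \<open>Concavity of \<open>ln\<close> in tangent form: together with the critical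
    equation it yields global minimality at \<open>\<beta>\<close> without differentiating the
    objective.\<close>
  have tangent: "ln y - ln z \<le> (y - z) / z" if "0 < y" "0 < z" for y z :: real
    using ln_le_minus_one[of "y / z"] that by (simp add: ln_div diff_divide_distrib)
  have exp_form: "2 powr c / ((1 - c) * (4 - c)) * real k powr (1 - c)
      = real k * exp (c * L - ln (1 - c) - ln (4 - c))" if "c < 1" for c
  proof -
    have "exp (c * L) = 2 powr c / real k powr c"
      using k by (simp add: L_def powr_def ln_div exp_diff[symmetric] algebra_simps)
    then show ?thesis
      using that k by (simp add: exp_diff powr_diff mult_ac)
  qed
  have "(1 - b - (1 - \<beta>)) / (1 - \<beta>) + (4 - b - (4 - \<beta>)) / (4 - \<beta>)
      = (\<beta> - b) * (1 / (1 - \<beta>) + 1 / (4 - \<beta>))"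
    by (simp add: algebra_simps diff_divide_distrib)
  also have "\<dots> = (\<beta> - b) * (- L)"
    using crit by (intro arg_cong[where f = "(*) _"]) linarith
  finally have "\<beta> * L - ln (1 - \<beta>) - ln (4 - \<beta>) \<le> b * L - ln (1 - b) - ln (4 - b)"
    using tangent[of "1 - b" "1 - \<beta>"] tangent[of "4 - b" "4 - \<beta>"] b \<beta>
    by (simp add: algebra_simps)
  then have "a_bar k * real k powr (1 - b_bar k)
      \<le> 2 powr b / ((1 - b) * (4 - b)) * real k powr (1 - b)"
    using exp_form[OF \<beta>(2)] exp_form[OF b(2)] k
    unfolding a_bar_def \<beta>_def[symmetric] by (simp add: mult_left_mono)
  also have "\<dots> \<le> a * real k powr (1 - b)"
    using a by (intro mult_right_mono) auto
  finally show ?thesis .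
qed

lemma exists_feasible_log_bound:
  assumes k: "k \<ge> 8"
  shows "\<exists>a b. feasible (a, b) \<and> a * real k powr (1 - b) \<le> 2 * ln (real k)"
proof -
  define b where "b = 1 - 1 / ln (real k)"
  define a where "a = 2 powr b / ((1 - b) * (4 - b))"
  have "ln (2 / real k) = ln 2 - ln (real k)"
    using k by (simp add: ln_div)
  then have ln: "1 < ln (real k)"
    using ln_two_over_less[OF k] ln_gt_zero[of "2::real"] by linarith
  then have b: "0 < b" "b < 1"
    by (auto simp: b_def)
  \<comment> \<open>The remaining factors are bounded crudely by \<open>2 powr b \<le> 2\<close> and
    \<open>4 - b \<ge> 3\<close>, while \<open>1 / (1 - b)\<close> is exactly
    \<open>ln k\<close>.\<close>
  have "2 powr b \<le> 2 powr (1::real)"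
    using b by (intro powr_mono) auto
  then have "a \<le> 2 / ((1 - b) * 3)"
    unfolding a_def using b by (intro frac_le mult_left_mono mult_pos_pos) auto
  also have "\<dots> = 2 / 3 * ln (real k)"
    using ln by (simp add: b_def)
  \<comment> \<open>For this \<open>b\<close>, \<open>real k powr (1 - b)\<close> equals
    \<open>exp 1\<close>.\<close>
  finally have "a * real k powr (1 - b) \<le> 2 / 3 * ln (real k) * exp 1"
    using k ln by (simp add: b_def powr_def)
  also have "\<dots> \<le> 2 / 3 * ln (real k) * 3"
    using ln exp_le by (intro mult_left_mono) auto
  finally have "a * real k powr (1 - b) \<le> 2 * ln (real k)"
    by simp
  moreover have "feasible (a, b)"
    using b by (simp add: feasible_iff a_def)
  ultimately show ?thesis
    by blast
qed

theorem corollary4: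
  fixes \<alpha> :: "nat \<Rightarrow> real"
  assumes "\<alpha> 1 = 1"
    and "\<And>k. k \<ge> 1 \<Longrightarrow> \<alpha> (k + 1) = 2 / (1 + sqrt (1 + 4 / (\<alpha> k)\<^sup>2))"
  shows "(\<forall>k\<ge>8. (\<forall>p. feasible p \<longrightarrow> lower_bound k p \<le> \<alpha> k) \<and>
                 is_arg_max (lower_bound k) feasible (a_bar k, b_bar k)) \<and>
         (\<lambda>k. (real k + 1) / 2 - inverse (\<alpha> k)) \<in> O(\<lambda>k. ln (real k))"
proof -
  define x where "x = (\<lambda>k. inverse (\<alpha> k))"
  have x1: "x 1 = 1"
    using assms(1) by (simp add: x_def)
  \<comment> \<open>This holds whatever the value of \<open>\<alpha> k\<close>: at 0, both
    \<open>4 / (\<alpha> k)\<^sup>2\<close> and \<open>x k\<close> default to 0.\<close>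
  have step: "x (k + 1) = (1 + sqrt (1 + 4 * (x k)\<^sup>2)) / 2" if "k \<ge> 1" for k
    unfolding x_def assms(2)[OF that] by (simp add: field_simps)
  note ge = recurrence_ge[OF x1 step] and le = recurrence_le[OF x1 step]
  have "lower_bound k p \<le> \<alpha> k" if k: "k \<ge> 8" and p: "feasible p" for k p
  proof -
    obtain a b where ab: "p = (a, b)"
      by fastforce
    have "0 < x k"
      using ge[of k] k by (simp add: less_le_trans[rotated])
    moreover have "x k \<le> (real k + 1 + a * real k powr (1 - b)) / 2"
      using le[of k a b] k p ab by simp
    ultimately have "inverse ((real k + 1 + a * real k powr (1 - b)) / 2) \<le> inverse (x k)"
      by (intro le_imp_inverse_le)
    then show ?thesis
      using k by (simp add: ab lower_bound_eq x_def)
  qed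
  moreover have "is_arg_max (lower_bound k) feasible (a_bar k, b_bar k)" if k: "k \<ge> 8" for k
  proof -
    have "lower_bound k (a, b) \<le> lower_bound k (a_bar k, b_bar k)" if ab: "feasible (a, b)" for a b
    proof -
      have "0 < a_bar k"
        using feasible_bar[OF k] by (simp add: feasible_def)
      then have "0 < real k + 1 + a_bar k * real k powr (1 - b_bar k)"
        using k by (intro add_pos_nonneg) auto
      then show ?thesis
        using bar_minimizes[OF k ab] k by (simp add: lower_bound_eq frac_le)
    qed
    then show ?thesis
      using feasible_bar[OF k] by (force simp: is_arg_max_def not_less)
  qed
  moreover have "(\<lambda>k. (real k + 1) / 2 - x k) \<in> O(\<lambda>k. ln (real k))"
  proof (intro bigoI eventually_sequentiallyI)
    fix k :: nat
    assume k: "8 \<le> k"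
    obtain a b where ab: "feasible (a, b)" "a * real k powr (1 - b) \<le> 2 * ln (real k)"
      using exists_feasible_log_bound[OF k] by blast
    \<comment> \<open>The two bounds confine the difference to the interval from
      \<open>- ln k\<close> to 0, so the constant 1 works.\<close>
    have "(real k + 1) / 2 \<le> x k" "x k \<le> (real k + 1) / 2 + ln (real k)"
      using ge[of k] le[of k a b] ab k by (simp_all add: add_divide_distrib)
    then show "norm ((real k + 1) / 2 - x k) \<le> 1 * norm (ln (real k))"
      by simp
  qed
  ultimately show ?thesis
    by (simp add: x_def)
qed

end
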